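(* Let $\sigma$ be a positive Borel measure on $\mathbb{R}$ with $\int_{\mathbb{R}}\frac{d\sigma(u)}{1+u^{2}}<\infty$, and let $\{X_\varphi\}_{\varphi\in\mathcal{S}}$ be the associated Gaussian process on $(\Omega,\mathcal{F},\mathbb{P}_\sigma)$, $\Omega=\mathcal{S}'$. Let $\{f_n\}_{n\in\mathbb{N}}$ be a real-valued frame in $L^{2}(\mathbb{R},\sigma)$ with frame bounds $0<a\le b<\infty$, so that for all $f\in L^2(\mathbb{R},\sigma)$ $$a\|f\|_{\sigma}^{2}\le\sum_{n\in\mathbb{N}}\left|\int_{\mathbb{R}}f(u)f_n(u)\,d\sigma(u)\right|^{2}\le b\|f\|_{\sigma}^{2}.$$ Let $\{B_n\}_{n\in\mathbb{N}}$ be a system of independent identically distributed $N(0,1)$ Gaussian random variables on $(\Omega,\mathcal{F},\mathbb{P}_\sigma)$, and set $$Y_\varphi(\cdot)=\sum_{n\in\mathbb{N}}\langle f_n,\widehat{\varphi}\rangle_{L^{2}(\sigma)}B_n(\cdot),\qquad\varphi\in\mathcal{S}.$$ Then for all $\varphi\in\mathcal{S}$ $$a\,\mathbb{E}_\sigma(|X_\varphi|^{2})\le\mathbb{E}_\sigma(|Y_\varphi|^{2})\le b\,\mathbb{E}_\sigma(|X_\varphi|^{2}).$$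
   Context: $\mathcal{S}=\mathcal{S}(\mathbb{R})$ is the Schwartz space of real-valued functions on $\mathbb{R}$ and $\mathcal{S}'$ its dual, the space of tempered distributions. The Fourier transform is $\widehat{\varphi}(u)=\int_{\mathbb{R}}e^{ixu}\varphi(x)\,dx$. $L^{2}(\mathbb{R},\sigma)=L^2(\sigma)$ consists of the functions $f$ on $\mathbb{R}$ with $\|f\|_\sigma^{2}=\int_{\mathbb{R}}|f(u)|^{2}d\sigma(u)<\infty$; it contains $\widehat{\varphi}$ for all $\varphi\in\mathcal{S}$. Its inner product is conjugate-linear in the first variable. $\mathbb{P}_\sigma$ is the unique probability measure on $\mathcal{S}'$ such that the functions $X_\varphi(w)=w(\varphi)$, $w\in\mathcal{S}'$, $\varphi\in\mathcal{S}$, are real-valued Gaussian random variables with $\mathbb{E}_\sigma(X_\varphi)=0$ and $\mathbb{E}_\sigma(e^{iX_\varphi})=\int_{\mathcal{S}'}e^{iX_\varphi}d\mathbb{P}_\sigma=e^{-\frac12\int_{\mathbb{R}}|\widehat{\varphi}(u)|^{2}d\sigma(u)}$ (in particular $\mathbb{E}_\sigma(X_\varphi^2)=\int_{\mathbb{R}}|\widehat{\varphi}|^2d\sigma$). $\mathbb{E}_\sigma$ is expectation with respect to $\mathbb{P}_\sigma$. The series defining $Y_\varphi$ converges in $L^{2}(\Omega,\mathbb{P}_\sigma)$. *)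

theory Defs
  imports "HOL-Probability.Probability"
begin

definition schwartz :: "(real \<Rightarrow> real) set" where
  "schwartz = {\<phi>. (\<forall>n x. (deriv ^^ n) \<phi> field_differentiable (at x)) \<and>
                  (\<forall>k n. bounded (range (\<lambda>x. x ^ k * (deriv ^^ n) \<phi> x)))}"

definition schwartz_seminorm :: "nat \<Rightarrow> nat \<Rightarrow> (real \<Rightarrow> real) \<Rightarrow> real" where
  "schwartz_seminorm k n \<phi> = (SUP x. \<bar>x ^ k * (deriv ^^ n) \<phi> x\<bar>)"

definition schwartz_topology :: "(real \<Rightarrow> real) topology" where
  "schwartz_topology = topology_generated_by
     {{\<psi> \<in> schwartz. schwartz_seminorm k n (\<lambda>x. \<psi> x - \<phi> x) < e} | k n \<phi> e.
        \<phi> \<in> schwartz \<and> 0 < e}"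

text \<open>A functional on the Schwartz space is encoded as a total function that is
  \<^const>\<open>undefined\<close> off the Schwartz space, so that functionals that agree there are equal.\<close>

definition tempered_distributions :: "((real \<Rightarrow> real) \<Rightarrow> real) set" where
  "tempered_distributions = {w \<in> extensional schwartz.
     (\<forall>\<phi>\<in>schwartz. \<forall>\<psi>\<in>schwartz. w (\<lambda>x. \<phi> x + \<psi> x) = w \<phi> + w \<psi>) \<and>
     (\<forall>c. \<forall>\<phi>\<in>schwartz. w (\<lambda>x. c * \<phi> x) = c * w \<phi>) \<and>
     continuous_map schwartz_topology euclideanreal w}"

text \<open>The \<open>\<sigma>\<close>-algebra generated by the evaluations \<open>w \<mapsto> w \<phi>\<close>; only the space and the
  measurable sets of this measure are used.\<close>

definition tempered_space :: "((real \<Rightarrow> real) \<Rightarrow> real) measure" where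
  "tempered_space =
     restrict_space (PiM schwartz (\<lambda>_. borel :: real measure)) tempered_distributions"

definition fourier :: "(real \<Rightarrow> real) \<Rightarrow> real \<Rightarrow> complex" where
  "fourier \<phi> u = (LINT x|lborel. exp (\<i> * complex_of_real (x * u)) * complex_of_real (\<phi> x))"

definition L2_space :: "'a measure \<Rightarrow> ('a \<Rightarrow> complex) set" where
  "L2_space M = {f \<in> borel_measurable M. integrable M (\<lambda>x. (cmod (f x))\<^sup>2)}"

definition L2_norm :: "'a measure \<Rightarrow> ('a \<Rightarrow> complex) \<Rightarrow> real" where
  "L2_norm M f = sqrt (LINT x|M. (cmod (f x))\<^sup>2)"

definition L2_inner :: "'a measure \<Rightarrow> ('a \<Rightarrow> complex) \<Rightarrow> ('a \<Rightarrow> complex) \<Rightarrow> complex" where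
  "L2_inner M f g = (LINT x|M. cnj (f x) * g x)"

definition L2_sums :: "'a measure \<Rightarrow> (nat \<Rightarrow> 'a \<Rightarrow> complex) \<Rightarrow> ('a \<Rightarrow> complex) \<Rightarrow> bool" where
  "L2_sums M g S \<longleftrightarrow> (\<forall>n. g n \<in> L2_space M) \<and> S \<in> L2_space M \<and>
     (\<lambda>N. L2_norm M (\<lambda>x. S x - (\<Sum>n<N. g n x))) \<longlonglongrightarrow> 0"

text \<open>A representative of the \<open>L\<^sup>2\<close> sum, which is determined only up to null sets;
  unspecified if the series does not converge in \<open>L\<^sup>2\<close>.\<close>

definition L2_suminf :: "'a measure \<Rightarrow> (nat \<Rightarrow> 'a \<Rightarrow> complex) \<Rightarrow> 'a \<Rightarrow> complex" where
  "L2_suminf M g = (SOME S. L2_sums M g S)"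

definition real_frame :: "'a measure \<Rightarrow> (nat \<Rightarrow> 'a \<Rightarrow> real) \<Rightarrow> real \<Rightarrow> real \<Rightarrow> bool" where
  "real_frame M f a b \<longleftrightarrow> 0 < a \<and> a \<le> b \<and>
     (\<forall>n. (\<lambda>x. complex_of_real (f n x)) \<in> L2_space M) \<and>
     (\<forall>g\<in>L2_space M.
        summable (\<lambda>n. (cmod (LINT x|M. g x * complex_of_real (f n x)))\<^sup>2) \<and>
        a * (L2_norm M g)\<^sup>2 \<le> (\<Sum>n. (cmod (LINT x|M. g x * complex_of_real (f n x)))\<^sup>2) \<and>
        (\<Sum>n. (cmod (LINT x|M. g x * complex_of_real (f n x)))\<^sup>2) \<le> b * (L2_norm M g)\<^sup>2)"

text \<open>Almost surely constant variables count as (degenerate) Gaussians: they occur as \<open>process_X \<phi>\<close>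
  when the Fourier transform of \<open>\<phi>\<close> vanishes \<open>\<sigma>\<close>-almost everywhere.\<close>

definition gaussian_variable :: "'a measure \<Rightarrow> ('a \<Rightarrow> real) \<Rightarrow> bool" where
  "gaussian_variable M Z \<longleftrightarrow> Z \<in> borel_measurable M \<and>
     (\<exists>\<mu>. (AE x in M. Z x = \<mu>) \<or> (\<exists>s>0. distributed M lborel Z (normal_density \<mu> s)))"

definition process_X :: "(real \<Rightarrow> real) \<Rightarrow> ((real \<Rightarrow> real) \<Rightarrow> real) \<Rightarrow> real" where
  "process_X \<phi> w = w \<phi>"

text \<open>The conditions that determine the measure \<open>P\<^sub>\<sigma>\<close> uniquely.\<close>

definition gaussian_measure :: "real measure \<Rightarrow> ((real \<Rightarrow> real) \<Rightarrow> real) measure \<Rightarrow> bool" where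
  "gaussian_measure \<sigma> P \<longleftrightarrow> prob_space P \<and> sets P = sets tempered_space \<and>
     (\<forall>\<phi>\<in>schwartz. gaussian_variable P (process_X \<phi>) \<and>
        (LINT w|P. process_X \<phi> w) = 0 \<and>
        (LINT w|P. exp (\<i> * complex_of_real (process_X \<phi> w))) =
          complex_of_real (exp (- (1/2) * (LINT u|\<sigma>. (cmod (fourier \<phi> u))\<^sup>2))))"

definition process_Y :: "real measure \<Rightarrow> ((real \<Rightarrow> real) \<Rightarrow> real) measure \<Rightarrow> (nat \<Rightarrow> real \<Rightarrow> real) \<Rightarrow>
    (nat \<Rightarrow> ((real \<Rightarrow> real) \<Rightarrow> real) \<Rightarrow> real) \<Rightarrow>
    (real \<Rightarrow> real) \<Rightarrow> ((real \<Rightarrow> real) \<Rightarrow> real) \<Rightarrow> complex" where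
  "process_Y \<sigma> P f B \<phi> = L2_suminf P
     (\<lambda>n w. L2_inner \<sigma> (\<lambda>u. complex_of_real (f n u)) (fourier \<phi>) * complex_of_real (B n w))"

end

theory Submission
  imports Defs
begin

text \<open>Fix a Schwartz function \<open>\<phi>\<close> and put \<open>c\<^sub>n = \<langle>f\<^sub>n, \<phi>^\<rangle>\<close>, where \<open>\<phi>^\<close> is its Fourier transform.
  Both second moments are norms of \<open>\<phi>^\<close> in disguise:
  \<open>E|X\<^sub>\<phi>|\<^sup>2 = \<parallel>\<phi>^\<parallel>\<^sup>2\<close> and \<open>E|Y\<^sub>\<phi>|\<^sup>2 = \<Sum>\<^sub>n |c\<^sub>n|\<^sup>2\<close>. The claim is then the frame inequality for the single
  function \<open>\<phi>^\<close>.

  The frame inequality may be used because \<open>\<phi>^\<close> lies in \<open>L\<^sup>2(\<sigma>)\<close>: an integration by parts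
  (\<open>fourier_deriv\<close>) shows \<open>|\<phi>^(u)|\<^sup>2 \<le> C / (1 + u\<^sup>2)\<close>, which is integrable by the growth condition
  on \<open>\<sigma>\<close> (\<open>fourier_in_L2_space\<close>).

  The first identity (\<open>process_X_second_moment\<close>) compares the prescribed characteristic
  function \<open>exp(-\<parallel>\<phi>^\<parallel>\<^sup>2/2)\<close> at \<open>1\<close> with that of a centred normal variable of variance \<open>s\<^sup>2\<close>,
  which is \<open>exp(-s\<^sup>2/2)\<close>; a degenerate variable corresponds to \<open>s = 0\<close>.

  The second identity (\<open>orthonormal_series_second_moment\<close>) is Parseval's identity, since
  independent standard normal variables are orthonormal in \<open>L\<^sup>2(P)\<close>. The frame property makes
  \<open>(c\<^sub>n)\<close> square summable, so the partial sums of \<open>\<Sum>\<^sub>n c\<^sub>n B\<^sub>n\<close> are Cauchy in \<open>L\<^sup>2(P)\<close>, and a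
  Riesz--Fischer argument produces a limit (\<open>orthonormal_series_L2_sums\<close>). As the limit is taken in
  \<open>L\<^sup>2\<close>, its norm is the limit of the norms of the partial sums (\<open>L2_norm_limit\<close>), whichever
  representative is chosen.\<close>

section \<open>Schwartz functions\<close>

lemma schwartz_deriv:
  assumes "\<phi> \<in> schwartz"
  shows "deriv \<phi> \<in> schwartz"
proof -
  have *: "(deriv ^^ n) (deriv \<phi>) = (deriv ^^ Suc n) \<phi>" for n
    by (simp add: funpow_swap1)
  show ?thesis
    using assms unfolding schwartz_def mem_Collect_eq * by blast
qed

lemma schwartz_has_derivative:
  assumes "\<phi> \<in> schwartz"
  shows "(\<phi> has_real_derivative deriv \<phi> x) (at x)"
proof -
  have "(deriv ^^ 0) \<phi> field_differentiable (at x)"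
    using assms unfolding schwartz_def mem_Collect_eq by blast
  then show ?thesis
    by (simp add: DERIV_deriv_iff_field_differentiable)
qed

lemma schwartz_isCont:
  assumes "\<phi> \<in> schwartz"
  shows "isCont \<phi> x"
  using schwartz_has_derivative[OF assms] by (rule DERIV_isCont)

lemma schwartz_measurable:
  assumes "\<phi> \<in> schwartz"
  shows "\<phi> \<in> borel_measurable borel"
  by (intro borel_measurable_continuous_onI continuous_at_imp_continuous_on ballI
      schwartz_isCont[OF assms])

text \<open>This decay rate is integrable over the line and makes boundary terms at infinity vanish.\<close>

lemma schwartz_quadratic_decay:
  assumes "\<phi> \<in> schwartz"
  obtains C where "0 \<le> C" "\<And>x. \<bar>\<phi> x\<bar> \<le> C * inverse (1 + x\<^sup>2)"
proof -
  have bd: "\<exists>K. \<forall>x. \<bar>x ^ k * \<phi> x\<bar> \<le> K" for k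
  proof -
    have "bounded (range (\<lambda>x. x ^ k * (deriv ^^ 0) \<phi> x))"
      using assms unfolding schwartz_def mem_Collect_eq by blast
    then show ?thesis by (auto simp: bounded_iff)
  qed
  from bd[of 0] obtain K where K: "\<And>x. \<bar>\<phi> x\<bar> \<le> K" by auto
  from bd[of 2] obtain L where L: "\<And>x. \<bar>x\<^sup>2 * \<phi> x\<bar> \<le> L" by auto
  have KL: "0 \<le> K + L"
    using K[of 0] L[of 0] by linarith
  show thesis
  proof (rule that[OF KL])
    fix x :: real
    have pos: "0 < 1 + x\<^sup>2" by (simp add: add_pos_nonneg)
    have "\<bar>\<phi> x\<bar> * (1 + x\<^sup>2) \<le> K + L"
      using K[of x] L[of x] by (simp add: abs_mult algebra_simps)
    then show "\<bar>\<phi> x\<bar> \<le> (K + L) * inverse (1 + x\<^sup>2)"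
      using pos by (simp add: field_simps)
  qed
qed

lemma schwartz_integrable:
  assumes "\<phi> \<in> schwartz"
  shows "integrable lborel \<phi>"
proof -
  obtain C where C: "0 \<le> C" "\<And>x. \<bar>\<phi> x\<bar> \<le> C * inverse (1 + x\<^sup>2)"
    using schwartz_quadratic_decay[OF assms] by blast
  have "integrable lborel (\<lambda>x::real. inverse (1 + x\<^sup>2))"
    using integrable_inverse_1_plus_square by (simp add: set_integrable_def)
  then have "integrable lborel (\<lambda>x. C * inverse (1 + x\<^sup>2))"
    by simp
  then show ?thesis
    by (rule Bochner_Integration.integrable_bound)
      (use schwartz_measurable[OF assms] C in \<open>auto simp: abs_mult abs_of_nonneg\<close>)
qed

lemma schwartz_vanishes_at_infinity:
  assumes "\<phi> \<in> schwartz"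
  shows "(\<phi> \<longlongrightarrow> 0) at_infinity"
proof -
  obtain C where C: "0 \<le> C" "\<And>x. \<bar>\<phi> x\<bar> \<le> C * inverse (1 + x\<^sup>2)"
    using schwartz_quadratic_decay[OF assms] by blast
  have "((\<lambda>x::real. C * inverse (1 + x\<^sup>2)) \<longlongrightarrow> C * 0) at_infinity"
    unfolding at_infinity_eq_at_top_bot
    by (intro filterlim_sup) real_asymp+
  then show ?thesis
    by (rule_tac Lim_null_comparison[rotated]) (use C in auto)
qed

section \<open>Fourier transforms of Schwartz functions are square integrable\<close>

lemma integrable_character_mult:
  assumes "\<phi> \<in> schwartz"
  shows "integrable lborel (\<lambda>x. exp (\<i> * complex_of_real (x * u)) * complex_of_real (\<phi> x))"
proof (rule Bochner_Integration.integrable_bound[OF schwartz_integrable[OF assms]])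
  note schwartz_measurable[OF assms, measurable]
  show "(\<lambda>x. exp (\<i> * complex_of_real (x * u)) * complex_of_real (\<phi> x)) \<in> borel_measurable lborel"
    by measurable
qed (simp add: norm_mult)

lemma fourier_bound:
  assumes "\<phi> \<in> schwartz"
  shows "cmod (fourier \<phi> u) \<le> (LINT x|lborel. \<bar>\<phi> x\<bar>)"
proof -
  have "cmod (fourier \<phi> u)
      \<le> (LINT x|lborel. cmod (exp (\<i> * complex_of_real (x * u)) * complex_of_real (\<phi> x)))"
    unfolding fourier_def by (rule integral_norm_bound)
  also have "\<dots> = (LINT x|lborel. \<bar>\<phi> x\<bar>)"
    by (simp add: norm_mult)
  finally show ?thesis .
qed

text \<open>Integration by parts: the derivative of \<open>x \<mapsto> e\<^sup>i\<^sup>x\<^sup>u \<phi>(x)\<close> has integral \<open>0\<close> over the line, because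
  \<open>\<phi>\<close> vanishes at both ends.\<close>

lemma fourier_deriv:
  assumes "\<phi> \<in> schwartz"
  shows "fourier (deriv \<phi>) u = - (\<i> * complex_of_real u * fourier \<phi> u)"
proof -
  define e where "e x = exp (\<i> * complex_of_real (x * u))" for x :: real
  define F where "F x = e x * complex_of_real (\<phi> x)" for x
  define G where "G x = \<i> * complex_of_real u * (e x * complex_of_real (\<phi> x))
      + e x * complex_of_real (deriv \<phi> x)" for x
  note d = schwartz_deriv[OF assms]
  have e: "(e has_vector_derivative (\<i> * complex_of_real u * e x)) (at x)" for x
  proof -
    have "((\<lambda>z. exp (\<i> * (z * complex_of_real u))) has_field_derivative
        \<i> * complex_of_real u * exp (\<i> * (of_real x * complex_of_real u))) (at (of_real x))"
      by (auto intro!: derivative_eq_intros)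
    from has_vector_derivative_real_field[OF this] show ?thesis
      by (simp add: e_def[abs_def] mult_ac)
  qed
  have F: "(F has_vector_derivative G x) (at x)" for x
  proof -
    have "((\<lambda>x. complex_of_real (\<phi> x)) has_vector_derivative complex_of_real (deriv \<phi> x)) (at x)"
      using schwartz_has_derivative[OF assms, of x]
      by (intro has_vector_derivative_of_real)
        (simp add: has_real_derivative_iff_has_vector_derivative)
    from has_vector_derivative_mult[OF e this] show ?thesis
      unfolding F_def G_def by (simp add: algebra_simps)
  qed
  have contG: "isCont G x" for x
    unfolding G_def e_def
    by (intro continuous_intros schwartz_isCont[OF d] schwartz_isCont[OF assms])
  have i1: "integrable lborel (\<lambda>x. e x * complex_of_real (\<phi> x))"
    and i2: "integrable lborel (\<lambda>x. e x * complex_of_real (deriv \<phi> x))"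
    unfolding e_def by (rule integrable_character_mult; fact)+
  have intG: "integrable lborel G"
    unfolding G_def using i1 i2 by simp
  have F0: "(F \<longlongrightarrow> 0) at_infinity"
    by (rule Lim_null_comparison[OF _ tendsto_rabs_zero[OF schwartz_vanishes_at_infinity[OF assms]]])
      (simp add: F_def e_def norm_mult)
  have "(LBINT x=-\<infinity>..\<infinity>. G x) = 0 - 0"
  proof (rule interval_integral_FTC_integrable[where F = F])
    show "set_integrable lborel (einterval (- \<infinity>) \<infinity>) G"
      using intG by (simp add: set_integrable_def)
    show "((F \<circ> real_of_ereal) \<longlongrightarrow> 0) (at_right (- \<infinity>))"
      unfolding ereal_tendsto_simps by (rule tendsto_mono[OF at_bot_le_at_infinity F0])
    show "((F \<circ> real_of_ereal) \<longlongrightarrow> 0) (at_left \<infinity>)"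
      unfolding ereal_tendsto_simps by (rule tendsto_mono[OF at_top_le_at_infinity F0])
  qed (use F contG in auto)
  then have "(LINT x|lborel. G x) = 0"
    by (simp add: interval_lebesgue_integral_def set_lebesgue_integral_def)
  moreover have "fourier \<psi> u = (LINT x|lborel. e x * complex_of_real (\<psi> x))" for \<psi>
    by (simp add: fourier_def e_def)
  ultimately show ?thesis
    using i1 i2 by (simp add: G_def eq_neg_iff_add_eq_0 add.commute)
qed

lemma fourier_measurable:
  assumes "\<phi> \<in> schwartz"
  shows "fourier \<phi> \<in> borel_measurable borel"
proof -
  note schwartz_measurable[OF assms, measurable]
  show ?thesis unfolding fourier_def[abs_def] by measurable
qed

text \<open>The bound on \<open>fourier \<phi>\<close> by the \<open>L\<^sup>1\<close> norm of \<open>\<phi>\<close>, applied to \<open>\<phi>\<close> and to its derivative, bounds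
  both \<open>|\<phi>^(u)|\<close> and \<open>|u \<phi>^(u)|\<close>. Hence \<open>(1 + u\<^sup>2) |\<phi>^(u)|\<^sup>2\<close> is bounded, which is what the growth
  condition on \<open>\<sigma>\<close> is made for.\<close>

lemma fourier_in_L2_space:
  assumes "sets \<sigma> = sets borel"
    and int: "integrable \<sigma> (\<lambda>u. 1 / (1 + u\<^sup>2))"
    and "\<phi> \<in> schwartz"
  shows "fourier \<phi> \<in> L2_space \<sigma>"
proof -
  define K where "K = (LINT x|lborel. \<bar>\<phi> x\<bar>)"
  define L where "L = (LINT x|lborel. \<bar>deriv \<phi> x\<bar>)"
  have m: "fourier \<phi> \<in> borel_measurable \<sigma>"
    using fourier_measurable[OF assms(3)] measurable_cong_sets[OF assms(1) refl] by blast
  have bound: "(cmod (fourier \<phi> u))\<^sup>2 \<le> (K\<^sup>2 + L\<^sup>2) * (1 / (1 + u\<^sup>2))" for u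
  proof -
    have "(cmod (fourier \<phi> u))\<^sup>2 \<le> K\<^sup>2"
      unfolding K_def by (intro power_mono fourier_bound assms) simp
    moreover have "u\<^sup>2 * (cmod (fourier \<phi> u))\<^sup>2 \<le> L\<^sup>2"
    proof -
      have "(cmod (fourier (deriv \<phi>) u))\<^sup>2 \<le> L\<^sup>2"
        unfolding L_def by (intro power_mono fourier_bound schwartz_deriv assms) simp
      then show ?thesis
        by (simp add: fourier_deriv[OF assms(3)] norm_mult power_mult_distrib)
    qed
    moreover have "0 < 1 + u\<^sup>2" by (simp add: add_pos_nonneg)
    ultimately show ?thesis by (simp add: field_simps)
  qed
  have "integrable \<sigma> (\<lambda>u. (cmod (fourier \<phi> u))\<^sup>2)"
    by (rule Bochner_Integration.integrable_bound[OF integrable_mult_right[OF int, of "K\<^sup>2 + L\<^sup>2"]])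
      (use m bound in \<open>auto simp: abs_of_nonneg\<close>)
  with m show ?thesis by (simp add: L2_space_def)
qed

section \<open>The second moment of the Gaussian process\<close>

lemma (in prob_space) normal_char:
  assumes s: "0 < s" and X: "distributed M lborel X (normal_density 0 s)"
  shows "(LINT x|M. exp (\<i> * complex_of_real (X x))) = complex_of_real (exp (- (s\<^sup>2) / 2))"
proof -
  have Z: "distributed M lborel (\<lambda>x. X x / s) std_normal_density"
    using X normal_standard_normal_convert[OF s, of X 0] by simp
  have [measurable]: "(\<lambda>x. X x / s) \<in> borel_measurable M"
    using distributed_measurable[OF Z] by simp
  have "complex_of_real (exp (- (s\<^sup>2) / 2)) = char (distr M borel (\<lambda>x. X x / s)) s"
    using Z by (simp add: char_std_normal_distribution distributed_def cong: distr_cong)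
  also have "\<dots> = (LINT x|M. exp (\<i> * complex_of_real (s * (X x / s))))"
    unfolding char_def by (subst integral_distr) auto
  finally show ?thesis using s by simp
qed

lemma (in prob_space) normal_second_moment:
  assumes s: "0 < s" and X: "distributed M lborel X (normal_density 0 s)"
  shows "(LINT x|M. (X x)\<^sup>2) = s\<^sup>2"
  using normal_distributed_variance[OF s X] normal_distributed_expectation[OF s X] by simp

text \<open>The characteristic function at \<open>1\<close> alone determines the variance of a centred Gaussian
  variable, since \<open>v \<mapsto> exp(-v/2)\<close> is injective on the reals.\<close>

lemma process_X_second_moment:
  assumes "gaussian_measure \<sigma> P" and "\<phi> \<in> schwartz"
  shows "(LINT w|P. \<bar>process_X \<phi> w\<bar>\<^sup>2) = (LINT u|\<sigma>. (cmod (fourier \<phi> u))\<^sup>2)"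
proof -
  interpret prob_space P
    using assms(1) by (simp add: gaussian_measure_def)
  let ?X = "process_X \<phi>" and ?I = "LINT u|\<sigma>. (cmod (fourier \<phi> u))\<^sup>2"
  have gv: "gaussian_variable P ?X" and mean: "(LINT w|P. ?X w) = 0"
    and ch: "(LINT w|P. exp (\<i> * complex_of_real (?X w))) = complex_of_real (exp (- (1/2) * ?I))"
    using assms unfolding gaussian_measure_def by blast+
  from gv have [measurable]: "?X \<in> borel_measurable P"
    by (simp add: gaussian_variable_def)
  from gv obtain \<mu> where
    "(AE x in P. ?X x = \<mu>) \<or> (\<exists>s>0. distributed P lborel ?X (normal_density \<mu> s))"
    by (auto simp: gaussian_variable_def)
  then show ?thesis
  proof
    assume const: "AE x in P. ?X x = \<mu>"
    have "(LINT w|P. ?X w) = (LINT w|P. \<mu>)"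
      using const by (intro integral_cong_AE) auto
    with mean have "\<mu> = 0" by (simp add: prob_space)
    with const have zero: "AE x in P. ?X x = 0" by simp
    have "(LINT w|P. exp (\<i> * complex_of_real (?X w))) = (LINT w|P. 1)"
      using zero by (intro integral_cong_AE) auto
    with ch have "complex_of_real (exp (- (1/2) * ?I)) = complex_of_real 1"
      by (simp add: prob_space)
    then have "exp (- (1/2) * ?I) = 1" by (simp only: of_real_eq_iff)
    then have "?I = 0" by simp
    moreover have "(LINT w|P. \<bar>?X w\<bar>\<^sup>2) = (LINT w|P. 0)"
      using zero by (intro integral_cong_AE) auto
    ultimately show ?thesis by simp
  next
    assume "\<exists>s>0. distributed P lborel ?X (normal_density \<mu> s)"
    then obtain s where s: "0 < s" and D: "distributed P lborel ?X (normal_density \<mu> s)" by blast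
    have "\<mu> = 0"
      using normal_distributed_expectation[OF s D] mean by simp
    with D have D: "distributed P lborel ?X (normal_density 0 s)" by simp
    have "complex_of_real (exp (- (1/2) * ?I)) = complex_of_real (exp (- (s\<^sup>2) / 2))"
      using normal_char[OF s D] ch by simp
    then have "exp (- (1/2) * ?I) = exp (- (s\<^sup>2) / 2)" by (simp only: of_real_eq_iff)
    then have "?I = s\<^sup>2" by simp
    then show ?thesis
      using normal_second_moment[OF s D] by simp
  qed
qed

section \<open>Square integrable functions and their limits\<close>

text \<open>A weighted form of Young's inequality. It replaces the triangle inequality of the \<open>L\<^sup>2\<close> norm:
  being pointwise and quadratic, it can be integrated directly, and the weight \<open>t\<close> is sent to \<open>0\<close>
  only after the limit along the sequence has been taken.\<close>

lemma norm_add_sq_weighted: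
  fixes x y :: "'a::real_normed_vector"
  assumes "0 < t"
  shows "(norm (x + y))\<^sup>2 \<le> (1 + t) * (norm x)\<^sup>2 + (1 + 1 / t) * (norm y)\<^sup>2"
proof -
  have "0 \<le> (t * norm x - norm y)\<^sup>2 / t"
    using assms by simp
  also have "\<dots> = t * (norm x)\<^sup>2 - 2 * norm x * norm y + (norm y)\<^sup>2 / t"
    using assms by (simp add: power2_diff field_simps power2_eq_square)
  finally have young: "2 * norm x * norm y \<le> t * (norm x)\<^sup>2 + (norm y)\<^sup>2 / t"
    by simp
  have "(norm (x + y))\<^sup>2 \<le> (norm x + norm y)\<^sup>2"
    by (intro power_mono norm_triangle_ineq) simp
  also have "\<dots> \<le> (1 + t) * (norm x)\<^sup>2 + (1 + 1 / t) * (norm y)\<^sup>2"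
    using young by (simp add: power2_sum algebra_simps)
  finally show ?thesis .
qed

lemma L2_space_add:
  assumes "g \<in> L2_space M" "h \<in> L2_space M"
  shows "(\<lambda>x. g x + h x) \<in> L2_space M"
proof -
  have [measurable]: "g \<in> borel_measurable M" "h \<in> borel_measurable M"
    using assms by (auto simp: L2_space_def)
  have "integrable M (\<lambda>x. 2 * (cmod (g x))\<^sup>2 + 2 * (cmod (h x))\<^sup>2)"
    using assms by (simp add: L2_space_def)
  then have "integrable M (\<lambda>x. (cmod (g x + h x))\<^sup>2)"
    by (rule Bochner_Integration.integrable_bound)
      (use norm_add_sq_weighted[of 1 "g _" "h _"] in \<open>auto simp: abs_of_nonneg\<close>)
  then show ?thesis by (simp add: L2_space_def)
qed

lemma L2_norm_sq: "(L2_norm M g)\<^sup>2 = (LINT x|M. (cmod (g x))\<^sup>2)"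
  by (simp add: L2_norm_def)

lemma L2_norm_add_sq_weighted:
  assumes g: "g \<in> L2_space M" and h: "h \<in> L2_space M" and "0 < t"
  shows "(L2_norm M (\<lambda>x. g x + h x))\<^sup>2
    \<le> (1 + t) * (L2_norm M g)\<^sup>2 + (1 + 1 / t) * (L2_norm M h)\<^sup>2"
proof -
  have int: "integrable M (\<lambda>x. (1 + t) * (cmod (g x))\<^sup>2)"
    "integrable M (\<lambda>x. (1 + 1 / t) * (cmod (h x))\<^sup>2)"
    using g h by (simp_all add: L2_space_def)
  have "(L2_norm M (\<lambda>x. g x + h x))\<^sup>2
      \<le> (LINT x|M. (1 + t) * (cmod (g x))\<^sup>2 + (1 + 1 / t) * (cmod (h x))\<^sup>2)"
    unfolding L2_norm_sq using L2_space_add[OF g h] int norm_add_sq_weighted[OF \<open>0 < t\<close>]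
    by (intro integral_mono Bochner_Integration.integrable_add) (auto simp: L2_space_def)
  also have "\<dots> = (1 + t) * (L2_norm M g)\<^sup>2 + (1 + 1 / t) * (L2_norm M h)\<^sup>2"
    unfolding L2_norm_sq by (subst Bochner_Integration.integral_add[OF int]) simp
  finally show ?thesis .
qed

lemma le_of_le_scaled:
  fixes x y :: real
  assumes "\<And>t. 0 < t \<Longrightarrow> x \<le> (1 + t) * y"
  shows "x \<le> y"
proof (rule tendsto_lowerbound)
  show "((\<lambda>t. (1 + t) * y) \<longlongrightarrow> y) (at_right 0)"
    by (auto intro!: tendsto_eq_intros)
  show "\<forall>\<^sub>F t in at_right 0. x \<le> (1 + t) * y"
    using assms by (auto simp: eventually_at_filter)
qed simp

text \<open>Compare \<open>S\<close> with \<open>s N\<close> in both directions by the weighted inequality. For a fixed weight \<open>t\<close> the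
  error term \<open>(1 + 1/t) \<parallel>S - s N\<parallel>\<^sup>2\<close> disappears as \<open>N\<close> grows; letting \<open>t\<close> tend to \<open>0\<close> afterwards
  removes the factor \<open>1 + t\<close>.\<close>

lemma L2_norm_limit:
  assumes S: "S \<in> L2_space M" and s: "\<And>N. s N \<in> L2_space M"
    and conv: "(\<lambda>N. L2_norm M (\<lambda>x. S x - s N x)) \<longlonglongrightarrow> 0"
    and V: "(\<lambda>N. (L2_norm M (s N))\<^sup>2) \<longlonglongrightarrow> V"
  shows "(L2_norm M S)\<^sup>2 = V"
proof (rule antisym; rule le_of_le_scaled)
  let ?d = "\<lambda>N x. S x - s N x"
  have neg: "(\<lambda>x. - g x) \<in> L2_space M" if "g \<in> L2_space M" for g
    using that by (simp add: L2_space_def)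
  have d: "?d N \<in> L2_space M" for N
    using L2_space_add[OF S neg[OF s]] by simp
  have d0: "(\<lambda>N. (1 + 1 / t) * (L2_norm M (?d N))\<^sup>2) \<longlonglongrightarrow> 0" for t
    using conv by (auto intro!: tendsto_eq_intros)
  fix t :: real assume t: "0 < t"
  have "(L2_norm M S)\<^sup>2 \<le> (1 + t) * (L2_norm M (s N))\<^sup>2 + (1 + 1 / t) * (L2_norm M (?d N))\<^sup>2" for N
    using L2_norm_add_sq_weighted[OF s[of N] d[of N] t] by simp
  moreover have "(\<lambda>N. (1 + t) * (L2_norm M (s N))\<^sup>2 + (1 + 1 / t) * (L2_norm M (?d N))\<^sup>2)
      \<longlonglongrightarrow> (1 + t) * V + 0"
    by (intro tendsto_add d0 tendsto_mult tendsto_const V)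
  ultimately show "(L2_norm M S)\<^sup>2 \<le> (1 + t) * V"
    by (auto intro: LIMSEQ_le_const)
  have "(L2_norm M (s N))\<^sup>2 \<le> (1 + t) * (L2_norm M S)\<^sup>2 + (1 + 1 / t) * (L2_norm M (?d N))\<^sup>2" for N
    using L2_norm_add_sq_weighted[OF S neg[OF d] t, of N]
    by (simp add: L2_norm_def norm_minus_commute)
  then show "V \<le> (1 + t) * (L2_norm M S)\<^sup>2"
    using LIMSEQ_le[OF V tendsto_add[OF tendsto_const d0[of t], of "(1 + t) * (L2_norm M S)\<^sup>2"]]
    by simp
qed

section \<open>Series of orthonormal random variables\<close>

text \<open>Integrability of the products is required explicitly, because the integral of a
  non-integrable function is \<open>0\<close> by convention and would pass for orthogonality.\<close>

definition orthonormal_variables :: "'a measure \<Rightarrow> (nat \<Rightarrow> 'a \<Rightarrow> real) \<Rightarrow> bool" where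
  "orthonormal_variables M B \<longleftrightarrow> (\<forall>n. B n \<in> borel_measurable M) \<and>
     (\<forall>i j. integrable M (\<lambda>x. B i x * B j x) \<and>
       (LINT x|M. B i x * B j x) = (if i = j then 1 else 0))"

lemma (in prob_space) iid_std_normal_orthonormal:
  assumes indep: "indep_vars (\<lambda>_. borel) B UNIV"
    and D: "\<And>n. distributed M lborel (B n) std_normal_density"
  shows "orthonormal_variables M B"
proof -
  have meas: "B n \<in> borel_measurable M" for n
    using distributed_measurable[OF D] by simp
  have int: "integrable M (B n)" for n
    using distributed_integrable[OF D, of "\<lambda>x. x"] integrable_std_normal_moment[of 1] by simp
  have int2: "integrable M (\<lambda>x. B n x * B n x)" for n
    using distributed_integrable[OF D, of "\<lambda>x. x * x"] integrable_std_normal_moment[of 2]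
    by (simp add: power2_eq_square)
  have "integrable M (\<lambda>x. B i x * B j x) \<and> (LINT x|M. B i x * B j x) = (if i = j then 1 else 0)"
    for i j
  proof (cases "i = j")
    case True
    then show ?thesis
      using int2 normal_second_moment[OF _ D, of i] by (simp add: power2_eq_square)
  next
    case False
    have I: "indep_vars (\<lambda>_. borel) B {i, j}"
      by (rule indep_vars_subset[OF indep]) auto
    have "(LINT x|M. (\<Prod>k\<in>{i, j}. B k x)) = (\<Prod>k\<in>{i, j}. LINT x|M. B k x)"
      by (rule indep_vars_lebesgue_integral[OF _ I]) (auto simp: int)
    moreover have "integrable M (\<lambda>x. \<Prod>k\<in>{i, j}. B k x)"
      by (rule indep_vars_integrable[OF _ I]) (auto simp: int)
    ultimately show ?thesis
      using False standard_normal_distributed_expectation[OF D] by simp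
  qed
  with meas show ?thesis by (simp add: orthonormal_variables_def)
qed

text \<open>Pythagoras: expanding \<open>|S|\<^sup>2\<close> as a double sum, only the diagonal terms survive integration.\<close>

lemma orthonormal_sum:
  fixes c :: "nat \<Rightarrow> complex"
  assumes "orthonormal_variables M B" and "finite A"
  defines "S \<equiv> \<lambda>x. \<Sum>n\<in>A. c n * complex_of_real (B n x)"
  shows "S \<in> L2_space M" and "(LINT x|M. (cmod (S x))\<^sup>2) = (\<Sum>n\<in>A. (cmod (c n))\<^sup>2)"
proof -
  have [measurable]: "B n \<in> borel_measurable M" for n
    using assms(1) by (simp add: orthonormal_variables_def)
  have int: "integrable M (\<lambda>x. B i x * B j x)"
    and orth: "(LINT x|M. B i x * B j x) = (if i = j then 1 else 0)" for i j
    using assms(1) by (simp_all add: orthonormal_variables_def)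
  have expand: "(cmod (S x))\<^sup>2 = (\<Sum>i\<in>A. \<Sum>j\<in>A. Re (c i * cnj (c j)) * (B i x * B j x))" for x
  proof -
    have "(cmod (S x))\<^sup>2 = Re (S x * cnj (S x))"
      by (metis Re_complex_of_real complex_norm_square)
    also have "S x * cnj (S x)
        = (\<Sum>i\<in>A. \<Sum>j\<in>A. (c i * cnj (c j)) * complex_of_real (B i x * B j x))"
      unfolding S_def by (simp add: sum_product mult_ac)
    finally show ?thesis by simp
  qed
  have "S \<in> borel_measurable M" unfolding S_def by measurable
  moreover have "integrable M (\<lambda>x. (cmod (S x))\<^sup>2)"
    unfolding expand using int by (intro Bochner_Integration.integrable_sum integrable_mult_right)
  ultimately show "S \<in> L2_space M" by (simp add: L2_space_def)
  have "(LINT x|M. (cmod (S x))\<^sup>2)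
      = (\<Sum>i\<in>A. \<Sum>j\<in>A. Re (c i * cnj (c j)) * (if i = j then 1 else 0))"
    unfolding expand using int
    by (simp add: Bochner_Integration.integral_sum orth del: times_complex.sel)
  also have "\<dots> = (\<Sum>n\<in>A. (cmod (c n))\<^sup>2)"
    using \<open>finite A\<close>
    by (simp add: if_distrib complex_norm_square[symmetric] del: times_complex.sel cong: if_cong)
  finally show "(LINT x|M. (cmod (S x))\<^sup>2) = (\<Sum>n\<in>A. (cmod (c n))\<^sup>2)" .
qed

text \<open>The \<open>L\<^sup>2\<close> norm dominates the \<open>L\<^sup>1\<close> norm because a variance is nonnegative.\<close>

lemma (in prob_space) expectation_norm_le_L2:
  assumes "h \<in> L2_space M"
  shows "integrable M h" and "(LINT x|M. cmod (h x)) \<le> sqrt (LINT x|M. (cmod (h x))\<^sup>2)"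
proof -
  have [measurable]: "h \<in> borel_measurable M" and i2: "integrable M (\<lambda>x. (cmod (h x))\<^sup>2)"
    using assms by (auto simp: L2_space_def)
  have "integrable M (\<lambda>x. cmod (h x))"
    by (rule square_integrable_imp_integrable) (use i2 in auto)
  then show "integrable M h" by (simp add: integrable_norm_iff)
  have "0 \<le> variance (\<lambda>x. cmod (h x))" by (rule variance_positive)
  also have "\<dots> = (LINT x|M. (cmod (h x))\<^sup>2) - (LINT x|M. cmod (h x))\<^sup>2"
    by (rule variance_eq) fact+
  finally show "(LINT x|M. cmod (h x)) \<le> sqrt (LINT x|M. (cmod (h x))\<^sup>2)"
    by (intro real_le_rsqrt) simp
qed

text \<open>The Riesz--Fischer argument. By Pythagoras the squared \<open>L\<^sup>2\<close> distance of two partial sums is the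
  difference of the corresponding partial sums of \<open>\<Sum>|c\<^sub>n|\<^sup>2\<close>. So the partial sums are Cauchy in
  \<open>L\<^sup>2\<close>, hence in \<open>L\<^sup>1\<close>, and some subsequence converges almost everywhere. Fatou's lemma along this
  subsequence shows that its pointwise limit is also the \<open>L\<^sup>2\<close> limit of the whole sequence.\<close>

lemma (in prob_space) orthonormal_series_L2_sums:
  fixes c :: "nat \<Rightarrow> complex"
  assumes ortho: "orthonormal_variables M B" and sm: "summable (\<lambda>n. (cmod (c n))\<^sup>2)"
  shows "\<exists>S. L2_sums M (\<lambda>n x. c n * complex_of_real (B n x)) S"
proof -
  define s where "s N x = (\<Sum>n<N. c n * complex_of_real (B n x))" for N x
  define V where "V N = (\<Sum>n<N. (cmod (c n))\<^sup>2)" for N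
  have sL2: "s N \<in> L2_space M" for N
    unfolding s_def[abs_def] by (rule orthonormal_sum[OF ortho]) simp
  then have [measurable]: "s N \<in> borel_measurable M" for N
    by (simp add: L2_space_def)
  have dL2: "(\<lambda>x. s i x - s j x) \<in> L2_space M"
    and dV: "(LINT x|M. (cmod (s i x - s j x))\<^sup>2) = \<bar>V i - V j\<bar>" for i j
  proof -
    have *: "(\<lambda>x. s i x - s j x) \<in> L2_space M \<and>
        (LINT x|M. (cmod (s i x - s j x))\<^sup>2) = V i - V j" if "j \<le> i" for i j
    proof -
      have eq: "s i x - s j x = (\<Sum>n\<in>{j..<i}. c n * complex_of_real (B n x))" for x
        using that by (simp add: s_def lessThan_atLeast0 sum_diff_nat_ivl)
      have eqV: "V i - V j = (\<Sum>n\<in>{j..<i}. (cmod (c n))\<^sup>2)"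
        using that by (simp add: V_def lessThan_atLeast0 sum_diff_nat_ivl)
      show ?thesis
        unfolding eq eqV using orthonormal_sum[OF ortho, of "{j..<i}" c] by simp
    qed
    have mono: "V j \<le> V i" if "j \<le> i" for i j
      unfolding V_def using that by (intro sum_mono2) auto
    have swap: "((\<lambda>x. s i x - s j x) \<in> L2_space M) = ((\<lambda>x. s j x - s i x) \<in> L2_space M)"
      by (simp add: L2_space_def norm_minus_commute borel_measurable_diff)
    show "(\<lambda>x. s i x - s j x) \<in> L2_space M"
      using *[of i j] *[of j i] swap linear by blast
    show "(LINT x|M. (cmod (s i x - s j x))\<^sup>2) = \<bar>V i - V j\<bar>"
      using *[of i j] *[of j i] mono[of i j] mono[of j i]
      by (cases "j \<le> i") (auto simp: norm_minus_commute)
  qed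
  have cauchyV: "\<exists>N. \<forall>i\<ge>N. \<forall>j\<ge>N. \<bar>V i - V j\<bar> < e" if "0 < e" for e
  proof -
    have "Cauchy V"
      unfolding V_def using summable_LIMSEQ[OF sm] by (rule LIMSEQ_imp_Cauchy)
    then show ?thesis using that by (auto simp: Cauchy_def dist_real_def)
  qed
  have "\<exists>N. \<forall>i\<ge>N. \<forall>j\<ge>N. (LINT x|M. norm (s i x - s j x)) < e" if "0 < e" for e
  proof -
    obtain N where N: "\<And>i j. i \<ge> N \<Longrightarrow> j \<ge> N \<Longrightarrow> \<bar>V i - V j\<bar> < e\<^sup>2"
      using cauchyV[of "e\<^sup>2"] \<open>0 < e\<close> by (metis zero_less_power)
    have "(LINT x|M. norm (s i x - s j x)) < e" if "i \<ge> N" "j \<ge> N" for i j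
    proof -
      have "(LINT x|M. norm (s i x - s j x)) \<le> sqrt \<bar>V i - V j\<bar>"
        using expectation_norm_le_L2(2)[OF dL2, of i j] by (simp add: dV)
      also have "\<dots> < sqrt (e\<^sup>2)" using N[OF that] by (rule real_sqrt_less_mono)
      finally show ?thesis using \<open>0 < e\<close> by simp
    qed
    then show ?thesis by blast
  qed
  then obtain r where r: "strict_mono r" and C: "AE x in M. Cauchy (\<lambda>i. s (r i) x)"
    using cauchy_L1_AE_cauchy_subseq[of M s] expectation_norm_le_L2(1)[OF sL2] by blast
  define S where "S x = lim (\<lambda>i. s (r i) x)" for x
  have [measurable]: "S \<in> borel_measurable M"
    unfolding S_def[abs_def] by measurable
  have lim: "AE x in M. (\<lambda>i. s (r i) x) \<longlonglongrightarrow> S x"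
    using C by eventually_elim (simp add: S_def Cauchy_convergent_iff convergent_LIMSEQ_iff)
  have fatou: "(\<integral>\<^sup>+x. ennreal ((cmod (S x - s N x))\<^sup>2) \<partial>M) \<le> ennreal e"
    if N: "\<And>i. i \<ge> N \<Longrightarrow> \<bar>V i - V N\<bar> < e" and "0 < e" for N e
  proof -
    have "(\<integral>\<^sup>+x. ennreal ((cmod (S x - s N x))\<^sup>2) \<partial>M)
        = (\<integral>\<^sup>+x. liminf (\<lambda>i. ennreal ((cmod (s (r i) x - s N x))\<^sup>2)) \<partial>M)"
    proof (rule nn_integral_cong_AE)
      show "AE x in M. ennreal ((cmod (S x - s N x))\<^sup>2)
          = liminf (\<lambda>i. ennreal ((cmod (s (r i) x - s N x))\<^sup>2))"
        using lim
      proof eventually_elim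
        case (elim x)
        have "(\<lambda>i. ennreal ((cmod (s (r i) x - s N x))\<^sup>2)) \<longlonglongrightarrow> ennreal ((cmod (S x - s N x))\<^sup>2)"
          by (intro tendsto_ennrealI tendsto_intros elim)
        then show ?case by (rule lim_imp_Liminf[OF sequentially_bot, symmetric])
      qed
    qed
    also have "\<dots> \<le> liminf (\<lambda>i. \<integral>\<^sup>+x. ennreal ((cmod (s (r i) x - s N x))\<^sup>2) \<partial>M)"
      by (rule nn_integral_liminf) measurable
    also have "\<dots> = liminf (\<lambda>i. ennreal \<bar>V (r i) - V N\<bar>)"
      using dL2 by (simp add: nn_integral_eq_integral L2_space_def dV)
    also have "\<dots> \<le> ennreal e"
    proof (rule Liminf_le)
      show "\<forall>\<^sub>F i in sequentially. ennreal \<bar>V (r i) - V N\<bar> \<le> ennreal e"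
        using eventually_ge_at_top[of N]
      proof eventually_elim
        case (elim i)
        then have "N \<le> r i" using seq_suble[OF r, of i] by simp
        from N[OF this] show ?case by (intro ennreal_leI) simp
      qed
    qed simp
    finally show ?thesis .
  qed
  have ev: "\<exists>N0. \<forall>N\<ge>N0. integrable M (\<lambda>x. (cmod (S x - s N x))\<^sup>2) \<and>
      (LINT x|M. (cmod (S x - s N x))\<^sup>2) \<le> e" if "0 < e" for e
  proof -
    obtain N0 where N0: "\<And>i j. i \<ge> N0 \<Longrightarrow> j \<ge> N0 \<Longrightarrow> \<bar>V i - V j\<bar> < e"
      using cauchyV[OF \<open>0 < e\<close>] by blast
    have "integrable M (\<lambda>x. (cmod (S x - s N x))\<^sup>2) \<and>
        (LINT x|M. (cmod (S x - s N x))\<^sup>2) \<le> e" if "N \<ge> N0" for N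
    proof -
      have le: "(\<integral>\<^sup>+x. ennreal ((cmod (S x - s N x))\<^sup>2) \<partial>M) \<le> ennreal e"
        by (rule fatou[OF _ \<open>0 < e\<close>]) (use N0 that in auto)
      then have i: "integrable M (\<lambda>x. (cmod (S x - s N x))\<^sup>2)"
        by (intro integrableI_bounded) (auto simp: le_less_trans)
      with le \<open>0 < e\<close> show ?thesis by (simp add: nn_integral_eq_integral)
    qed
    then show ?thesis by blast
  qed
  have "S \<in> L2_space M"
  proof -
    obtain N where "integrable M (\<lambda>x. (cmod (S x - s N x))\<^sup>2)"
      using ev[of 1] by auto
    then have "(\<lambda>x. S x - s N x) \<in> L2_space M"
      by (simp add: L2_space_def)
    from L2_space_add[OF this sL2[of N]] show ?thesis by simp
  qed
  moreover have "(\<lambda>n x. c n * complex_of_real (B n x)) n \<in> L2_space M" for n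
    using orthonormal_sum(1)[OF ortho, of "{n}" c] by simp
  moreover have "(\<lambda>N. L2_norm M (\<lambda>x. S x - s N x)) \<longlonglongrightarrow> 0"
  proof -
    have "(\<lambda>N. LINT x|M. (cmod (S x - s N x))\<^sup>2) \<longlonglongrightarrow> 0"
    proof (rule LIMSEQ_I)
      fix e :: real assume "0 < e"
      then obtain N0 where "\<And>N. N \<ge> N0 \<Longrightarrow> (LINT x|M. (cmod (S x - s N x))\<^sup>2) \<le> e / 2"
        using ev[of "e / 2"] by auto
      with \<open>0 < e\<close> show "\<exists>no. \<forall>n\<ge>no. norm ((LINT x|M. (cmod (S x - s n x))\<^sup>2) - 0) < e"
        by (intro exI[of _ N0]) (force simp: abs_of_nonneg)
    qed
    from tendsto_real_sqrt[OF this] show ?thesis by (simp add: L2_norm_def)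
  qed
  ultimately have "L2_sums M (\<lambda>n x. c n * complex_of_real (B n x)) S"
    by (simp add: L2_sums_def s_def)
  then show ?thesis by blast
qed

lemma (in prob_space) orthonormal_series_second_moment:
  fixes c :: "nat \<Rightarrow> complex"
  assumes ortho: "orthonormal_variables M B" and sm: "summable (\<lambda>n. (cmod (c n))\<^sup>2)"
  shows "(LINT x|M. (cmod (L2_suminf M (\<lambda>n x. c n * complex_of_real (B n x)) x))\<^sup>2)
    = (\<Sum>n. (cmod (c n))\<^sup>2)"
proof -
  let ?g = "\<lambda>n x. c n * complex_of_real (B n x)"
  let ?S = "L2_suminf M ?g"
  have "L2_sums M ?g ?S"
    unfolding L2_suminf_def by (rule someI_ex[OF orthonormal_series_L2_sums[OF ortho sm]])
  then have S: "?S \<in> L2_space M"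
    and conv: "(\<lambda>N. L2_norm M (\<lambda>x. ?S x - (\<Sum>n<N. ?g n x))) \<longlonglongrightarrow> 0"
    by (auto simp: L2_sums_def)
  have "(L2_norm M ?S)\<^sup>2 = (\<Sum>n. (cmod (c n))\<^sup>2)"
  proof (rule L2_norm_limit[OF S _ conv])
    show "(\<lambda>x. \<Sum>n<N. ?g n x) \<in> L2_space M" for N
      by (rule orthonormal_sum[OF ortho]) simp
    show "(\<lambda>N. (L2_norm M (\<lambda>x. \<Sum>n<N. ?g n x))\<^sup>2) \<longlonglongrightarrow> (\<Sum>n. (cmod (c n))\<^sup>2)"
      unfolding L2_norm_sq by (subst orthonormal_sum(2)[OF ortho]) (simp_all add: summable_LIMSEQ[OF sm])
  qed
  then show ?thesis by (simp add: L2_norm_sq)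
qed

section \<open>The frame bounds for the second moments\<close>

theorem theorem2:
  fixes \<sigma> :: "real measure"
    and P :: "((real \<Rightarrow> real) \<Rightarrow> real) measure"
    and f :: "nat \<Rightarrow> real \<Rightarrow> real"
    and a b :: real
    and B :: "nat \<Rightarrow> ((real \<Rightarrow> real) \<Rightarrow> real) \<Rightarrow> real"
  assumes "sets \<sigma> = sets borel"
    and "integrable \<sigma> (\<lambda>u. 1 / (1 + u\<^sup>2))"
    and "gaussian_measure \<sigma> P"
    and "real_frame \<sigma> f a b"
    and "prob_space.indep_vars P (\<lambda>_. borel) B UNIV"
    and "\<And>n. distributed P lborel (B n) (normal_density 0 1)"
  shows "\<forall>\<phi>\<in>schwartz.
     a * (LINT w|P. \<bar>process_X \<phi> w\<bar>\<^sup>2) \<le> (LINT w|P. (cmod (process_Y \<sigma> P f B \<phi> w))\<^sup>2) \<and>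
     (LINT w|P. (cmod (process_Y \<sigma> P f B \<phi> w))\<^sup>2) \<le> b * (LINT w|P. \<bar>process_X \<phi> w\<bar>\<^sup>2)"
proof
  fix \<phi> assume \<phi>: "\<phi> \<in> schwartz"
  interpret prob_space P
    using assms(3) by (simp add: gaussian_measure_def)
  define c where "c n = L2_inner \<sigma> (\<lambda>u. complex_of_real (f n u)) (fourier \<phi>)" for n
  have c: "c n = (LINT u|\<sigma>. fourier \<phi> u * complex_of_real (f n u))" for n
    by (simp add: c_def L2_inner_def mult.commute)
  have "fourier \<phi> \<in> L2_space \<sigma>"
    by (rule fourier_in_L2_space[OF assms(1,2) \<phi>])
  then have sm: "summable (\<lambda>n. (cmod (c n))\<^sup>2)"
    and lower: "a * (L2_norm \<sigma> (fourier \<phi>))\<^sup>2 \<le> (\<Sum>n. (cmod (c n))\<^sup>2)"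
    and upper: "(\<Sum>n. (cmod (c n))\<^sup>2) \<le> b * (L2_norm \<sigma> (fourier \<phi>))\<^sup>2"
    using assms(4) unfolding real_frame_def c by blast+
  have "orthonormal_variables P B"
    by (rule iid_std_normal_orthonormal[OF assms(5,6)])
  then have "(LINT w|P. (cmod (process_Y \<sigma> P f B \<phi> w))\<^sup>2) = (\<Sum>n. (cmod (c n))\<^sup>2)"
    unfolding process_Y_def c_def[symmetric]
    by (rule orthonormal_series_second_moment[OF _ sm])
  moreover have "(LINT w|P. \<bar>process_X \<phi> w\<bar>\<^sup>2) = (L2_norm \<sigma> (fourier \<phi>))\<^sup>2"
    using process_X_second_moment[OF assms(3) \<phi>] by (simp add: L2_norm_sq)
  ultimately show "a * (LINT w|P. \<bar>process_X \<phi> w\<bar>\<^sup>2) \<le> (LINT w|P. (cmod (process_Y \<sigma> P f B \<phi> w))\<^sup>2) \<and>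
     (LINT w|P. (cmod (process_Y \<sigma> P f B \<phi> w))\<^sup>2) \<le> b * (LINT w|P. \<bar>process_X \<phi> w\<bar>\<^sup>2)"
    using lower upper by simp
qed

end
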